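(* Let $(S,+)$ be a commutative cancellative semigroup and let $S-S$ denote its difference group. If $A\subseteq S$ is a $C$-set in $S$, then $A$ is a $C$-set in $S-S$.
   Context: For a commutative cancellative semigroup $(S,+)$, the difference group $(S-S,+)$ consists of all $a-b$ with $a,b\in S$, where $a-b$ is the element with $b+(a-b)=a$; it is a commutative group and $S\subseteq S-S$. For a set $Y$, $\mathcal P_f(Y)$ is the set of finite nonempty subsets of $Y$. For a commutative semigroup $(X,+)$, $B\subseteq X$ and $t\in X$, write $-t+B=\{y\in X:t+y\in B\}$. A set $B\subseteq X$ is a $J$-set in $X$ if for each finite nonempty set $F$ of sequences $f:\mathbb N\to X$ there exist $m\in\mathbb N$, $a\in X^{m+1}$ and $t(1)<t(2)<\dots<t(m)$ in $\mathbb N$ such that $\sum_{j=1}^m\bigl(a(j)+f(t(j))\bigr)+a(m+1)\in B$ for every $f\in F$. A family $\langle C_F\rangle_{F\in\mathcal I}$ is downward directed if $(\mathcal I,\geq)$ is directed and $F\geq G$ implies $C_F\subseteq C_G$. A set $A\subseteq X$ is a $C$-set in $X$ if there is a downward directed family $\langle C_F\rangle_{F\in\mathcal I}$ of subsets of $A$ such that (1) for each $F\in\mathcal I$ and each $x\in C_F$ there is $G\in\mathcal I$ with $C_G\subseteq -x+C_F$, and (2) for each $\mathcal F\in\mathcal P_f(\mathcal I)$, $\bigcap_{F\in\mathcal F}C_F$ is a $J$-set in $X$. *)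

theory Defs
  imports Main
begin

text \<open>
  A commutative cancellative semigroup is a type of sort
  \<open>{ab_semigroup_add, cancel_semigroup_add}\<close>. The class \<open>cancel_ab_semigroup_add\<close> would not do,
  as it also postulates a subtraction operation on the semigroup itself.
\<close>

subsection \<open>The difference group\<close>

text \<open>The pair \<open>(a, b)\<close> represents \<open>a - b\<close>.\<close>

definition diff_rel ::
    "'a::{ab_semigroup_add, cancel_semigroup_add} \<times> 'a \<Rightarrow> 'a \<times> 'a \<Rightarrow> bool" where
  "diff_rel p q \<longleftrightarrow> fst p + snd q = fst q + snd p"

lemma equivp_diff_rel:
  "equivp (diff_rel :: 'a::{ab_semigroup_add, cancel_semigroup_add} \<times> 'a \<Rightarrow> _)"
proof (rule equivpI)
  show "reflp (diff_rel :: 'a \<times> 'a \<Rightarrow> _)" by (simp add: reflp_def diff_rel_def)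
  show "symp (diff_rel :: 'a \<times> 'a \<Rightarrow> _)" by (simp add: symp_def diff_rel_def)
  show "transp (diff_rel :: 'a \<times> 'a \<Rightarrow> _)"
  proof (rule transpI)
    fix p q r :: "'a \<times> 'a"
    assume "diff_rel p q" and "diff_rel q r"
    then have pq: "fst p + snd q = fst q + snd p" and qr: "fst q + snd r = fst r + snd q"
      by (simp_all add: diff_rel_def)
    have "(fst p + snd r) + snd q = (fst p + snd q) + snd r" by (simp only: ac_simps)
    also have "\<dots> = (fst q + snd r) + snd p" by (simp only: pq) (simp only: ac_simps)
    also have "\<dots> = (fst r + snd p) + snd q" by (simp only: qr) (simp only: ac_simps)
    finally have "fst p + snd r = fst r + snd p" by (rule add_right_imp_eq)
    then show "diff_rel p r" by (simp add: diff_rel_def)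
  qed
qed

quotient_type (overloaded) 'a diff_group =
    "'a::{ab_semigroup_add, cancel_semigroup_add} \<times> 'a" / diff_rel
  by (rule equivp_diff_rel)

instantiation diff_group :: ("{ab_semigroup_add, cancel_semigroup_add}") ab_group_add
begin

text \<open>The semigroup need not have a neutral element, so zero is the class of some \<open>(c, c)\<close>.\<close>

lift_definition zero_diff_group :: "'a diff_group" is "(undefined, undefined)" .

lift_definition plus_diff_group :: "'a diff_group \<Rightarrow> 'a diff_group \<Rightarrow> 'a diff_group"
  is "\<lambda>p q. (fst p + fst q, snd p + snd q)"
proof -
  fix p q r s :: "'a \<times> 'a"
  assume pq: "diff_rel p q" and rs: "diff_rel r s"
  have "(fst p + fst r) + (snd q + snd s) = (fst p + snd q) + (fst r + snd s)"
    by (simp add: ac_simps)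
  also have "\<dots> = (fst q + snd p) + (fst s + snd r)"
    using pq rs by (simp add: diff_rel_def)
  also have "\<dots> = (fst q + fst s) + (snd p + snd r)" by (simp add: ac_simps)
  finally show "diff_rel (fst p + fst r, snd p + snd r) (fst q + fst s, snd q + snd s)"
    by (simp add: diff_rel_def)
qed

lift_definition uminus_diff_group :: "'a diff_group \<Rightarrow> 'a diff_group"
  is "\<lambda>p. (snd p, fst p)"
  by (simp add: diff_rel_def ac_simps)

definition minus_diff_group :: "'a diff_group \<Rightarrow> 'a diff_group \<Rightarrow> 'a diff_group" where
  "minus_diff_group x y = x + - y"

instance
proof
  fix x y z :: "'a diff_group"
  show "x + y + z = x + (y + z)" by transfer (simp add: diff_rel_def ac_simps)
  show "x + y = y + x" by transfer (simp add: diff_rel_def ac_simps)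
  show "0 + x = x" by transfer (simp add: diff_rel_def ac_simps)
  show "- x + x = 0" by transfer (simp add: diff_rel_def ac_simps)
  show "x - y = x + - y" by (rule minus_diff_group_def)
qed

end

text \<open>
  The canonical inclusion of the semigroup into its difference group; \<open>a\<close> is \<open>(a + a) - a\<close>.
\<close>

lift_definition diff_embed ::
    "'a::{ab_semigroup_add, cancel_semigroup_add} \<Rightarrow> 'a diff_group"
  is "\<lambda>a. (a + a, a)" .

lemma diff_embed_add: "diff_embed (a + b) = diff_embed a + diff_embed b"
  by transfer (simp add: diff_rel_def ac_simps)

lemma inj_diff_embed: "inj diff_embed"
proof (rule injI)
  fix a b :: 'a
  assume "diff_embed a = diff_embed b"
  then have "a + a + b = b + b + a" by transfer (simp add: diff_rel_def)
  then have "a + (a + b) = b + (a + b)" by (simp add: ac_simps)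
  then show "a = b" by (rule add_right_imp_eq)
qed

lemma diff_group_eq_diff: "\<exists>a b. x = diff_embed a - diff_embed b"
proof -
  obtain p where x: "x = abs_diff_group p"
    by (induction x rule: diff_group.abs_induct) blast
  have "x = diff_embed (fst p) + - diff_embed (snd p)"
    unfolding x by transfer (simp add: diff_rel_def ac_simps)
  then show ?thesis unfolding minus_diff_group_def by (intro exI)
qed


subsection \<open>J-sets\<close>

text \<open>
  \<open>semigroup_sum g m\<close> is \<open>g 1 + \<dots> + g m\<close> for \<open>m \<ge> 1\<close>, in a semigroup without neutral element
  (so that \<^const>\<open>sum\<close> is not available). The value at \<open>m = 0\<close> is irrelevant.
\<close>

primrec semigroup_sum :: "(nat \<Rightarrow> 'a::ab_semigroup_add) \<Rightarrow> nat \<Rightarrow> 'a" where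
  "semigroup_sum g 0 = undefined"
| "semigroup_sum g (Suc n) = (if n = 0 then g 1 else semigroup_sum g n + g (Suc n))"

lemma semigroup_sum_eq_sum:
  fixes g :: "nat \<Rightarrow> 'a::comm_monoid_add"
  assumes "1 \<le> m"
  shows "semigroup_sum g m = (\<Sum>j=1..m. g j)"
  using assms by (induction m rule: nat_induct_at_least) auto

text \<open>
  Sequences are indexed by the positive integers: \<open>t\<close> takes values \<open>\<ge> 1\<close>, and \<open>f 0\<close> is never used.
  Of \<open>a\<close> only \<open>a 1, \<dots>, a (m + 1)\<close> matter, and of \<open>t\<close> only \<open>t 1, \<dots>, t m\<close>.
\<close>

definition J_set :: "'a::ab_semigroup_add set \<Rightarrow> bool" where
  "J_set B \<longleftrightarrow>
     (\<forall>F :: (nat \<Rightarrow> 'a) set. finite F \<and> F \<noteq> {} \<longrightarrow>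
        (\<exists>(m::nat) (a :: nat \<Rightarrow> 'a) (t :: nat \<Rightarrow> nat).
           1 \<le> m \<and> (\<forall>j\<in>{1..m}. 1 \<le> t j) \<and> strict_mono_on {1..m} t \<and>
           (\<forall>f\<in>F. semigroup_sum (\<lambda>j. a j + f (t j)) m + a (m + 1) \<in> B)))"


subsection \<open>C-sets\<close>

definition neg_translate :: "'a::ab_semigroup_add \<Rightarrow> 'a set \<Rightarrow> 'a set" where
  "neg_translate t B = {y. t + y \<in> B}"

text \<open>In the following two definitions, \<open>(F, G) \<in> ge\<close> stands for \<open>F \<ge> G\<close>.\<close>

definition directed_index :: "'i set \<Rightarrow> ('i \<times> 'i) set \<Rightarrow> bool" where
  "directed_index I ge \<longleftrightarrow>
     I \<noteq> {} \<and> preorder_on I ge \<and>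
     (\<forall>F\<in>I. \<forall>G\<in>I. \<exists>H\<in>I. (H, F) \<in> ge \<and> (H, G) \<in> ge)"

definition downward_directed :: "'i set \<Rightarrow> ('i \<times> 'i) set \<Rightarrow> ('i \<Rightarrow> 'a set) \<Rightarrow> bool" where
  "downward_directed I ge C \<longleftrightarrow>
     directed_index I ge \<and> (\<forall>F\<in>I. \<forall>G\<in>I. (F, G) \<in> ge \<longrightarrow> C F \<subseteq> C G)"

definition C_set_family ::
    "'a::ab_semigroup_add set \<Rightarrow> 'i set \<Rightarrow> ('i \<times> 'i) set \<Rightarrow> ('i \<Rightarrow> 'a set) \<Rightarrow> bool" where
  "C_set_family A I ge C \<longleftrightarrow>
     downward_directed I ge C \<and>
     (\<forall>F\<in>I. C F \<subseteq> A) \<and>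
     (\<forall>F\<in>I. \<forall>x\<in>C F. \<exists>G\<in>I. C G \<subseteq> neg_translate x (C F)) \<and>
     (\<forall>\<F>. finite \<F> \<and> \<F> \<noteq> {} \<and> \<F> \<subseteq> I \<longrightarrow> J_set (\<Inter>F\<in>\<F>. C F))"

text \<open>
  HOL cannot quantify existentially over the type of the index set, so indices are drawn from
  the type of subsets of the semigroup. By lemma \<open>C_setI\<close> below this loses nothing: a family over
  an index set of any type at all can be re-indexed by its own members.
\<close>

definition C_set :: "'a::ab_semigroup_add set \<Rightarrow> bool" where
  "C_set A \<longleftrightarrow>
     (\<exists>(I :: 'a set set) (ge :: ('a set \<times> 'a set) set) (C :: 'a set \<Rightarrow> 'a set).
        C_set_family A I ge C)"

lemma C_setI:
  fixes A :: "'a::ab_semigroup_add set" and I :: "'i set"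
  assumes "C_set_family A I ge C"
  shows "C_set A"
proof -
  let ?I = "C ` I"
  let ?ge = "{(U, V). U \<in> ?I \<and> V \<in> ?I \<and> U \<subseteq> V}"
  have dd: "directed_index I ge" and mono: "\<And>F G. F \<in> I \<Longrightarrow> G \<in> I \<Longrightarrow> (F, G) \<in> ge \<Longrightarrow> C F \<subseteq> C G"
    and sub: "\<And>F. F \<in> I \<Longrightarrow> C F \<subseteq> A"
    and tr: "\<And>F x. F \<in> I \<Longrightarrow> x \<in> C F \<Longrightarrow> \<exists>G\<in>I. C G \<subseteq> neg_translate x (C F)"
    and J: "\<And>\<F>. finite \<F> \<Longrightarrow> \<F> \<noteq> {} \<Longrightarrow> \<F> \<subseteq> I \<Longrightarrow> J_set (\<Inter>F\<in>\<F>. C F)"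
    using assms by (auto simp: C_set_family_def downward_directed_def)
  have "preorder_on ?I ?ge"
    by (auto simp: preorder_on_def refl_on_def trans_def)
  moreover have "\<exists>W\<in>?I. (W, U) \<in> ?ge \<and> (W, V) \<in> ?ge" if "U \<in> ?I" "V \<in> ?I" for U V
  proof -
    from that obtain F G where FG: "F \<in> I" "U = C F" "G \<in> I" "V = C G" by auto
    with dd obtain H where "H \<in> I" "(H, F) \<in> ge" "(H, G) \<in> ge"
      unfolding directed_index_def by meson
    with FG mono have "C H \<in> ?I" "C H \<subseteq> U" "C H \<subseteq> V" by auto
    with that show ?thesis by blast
  qed
  ultimately have "directed_index ?I ?ge"
    using dd by (simp add: directed_index_def)
  then have 1: "downward_directed ?I ?ge (\<lambda>U. U)"
    unfolding downward_directed_def by blast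
  have 2: "\<forall>U\<in>?I. \<forall>x\<in>U. \<exists>V\<in>?I. V \<subseteq> neg_translate x U"
    using tr by simp
  have 3: "J_set (\<Inter>U\<in>\<U>. U)" if U: "finite \<U>" "\<U> \<noteq> {}" "\<U> \<subseteq> ?I" for \<U>
  proof -
    obtain \<F> where F: "\<F> \<subseteq> I" "finite \<F>" "\<U> = C ` \<F>"
      using finite_subset_image[OF U(1,3)] by blast
    with U(2) have "J_set (\<Inter>F\<in>\<F>. C F)" by (intro J) auto
    with F(3) show ?thesis by simp
  qed
  have "C_set_family A ?I ?ge (\<lambda>U. U)"
    unfolding C_set_family_def
  proof (intro conjI)
    show "\<forall>U\<in>?I. U \<subseteq> A" using sub by simp
  qed (use 1 2 3 in simp_all)
  then show ?thesis unfolding C_set_def by (intro exI)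
qed

end

theory Submission
  imports Defs
begin

text \<open>
  The point is that J-sets of the semigroup are J-sets of the difference group. Finitely many
  sequences in the group can be moved into the semigroup by adding one and the same sequence \<open>b\<close>
  of semigroup elements (a common denominator at each index). Apply the J-set property to the
  shifted sequences and absorb the terms \<open>b (t j)\<close> into the coefficients \<open>a j\<close>.
\<close>

text \<open>The bound keeps away from the value \<open>undefined\<close> at 0, which
  \<open>diff_embed\<close> need not preserve.\<close>

lemma diff_embed_semigroup_sum:
  assumes "1 \<le> m"
  shows "diff_embed (semigroup_sum g m) = semigroup_sum (\<lambda>j. diff_embed (g j)) m"
  using assms by (induction m rule: nat_induct_at_least) (auto simp: diff_embed_add)

lemma semigroup_sum_cong:
  assumes "1 \<le> m" and "\<And>j. 1 \<le> j \<Longrightarrow> j \<le> m \<Longrightarrow> g j = h j"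
  shows "semigroup_sum g m = semigroup_sum h m"
  using assms by (induction m rule: nat_induct_at_least) auto

text \<open>Denominators add up: if \<open>b\<close> clears \<open>X\<close> and \<open>x\<close> is
  \<open>p - q\<close>, then \<open>q + b\<close> clears both, since the image of the semigroup is
  closed under addition.\<close>

lemma common_denominator:
  fixes X :: "'a::{ab_semigroup_add, cancel_semigroup_add} diff_group set"
  assumes "finite X"
  shows "\<exists>b. \<forall>x\<in>X. diff_embed b + x \<in> range diff_embed"
  using assms
proof induction
  case empty
  then show ?case by simp
next
  case (insert x X)
  then obtain b where b: "\<forall>y\<in>X. diff_embed b + y \<in> range diff_embed" by blast
  obtain p q where x: "x = diff_embed p - diff_embed q"
    using diff_group_eq_diff by blast
  have "diff_embed (q + b) + x = diff_embed (b + p)"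
    by (simp add: x diff_embed_add algebra_simps)
  moreover have "diff_embed (q + b) + y \<in> range diff_embed" if "y \<in> X" for y
  proof -
    from b that obtain s where "diff_embed b + y = diff_embed s" by blast
    then have "diff_embed (q + b) + y = diff_embed (q + s)"
      by (simp add: diff_embed_add add.assoc)
    then show ?thesis by simp
  qed
  ultimately have "\<forall>y\<in>insert x X. diff_embed (q + b) + y \<in> range diff_embed" by auto
  then show ?case by blast
qed

lemma J_set_diff_embed:
  fixes B :: "'a::{ab_semigroup_add, cancel_semigroup_add} set"
  assumes "J_set B"
  shows "J_set (diff_embed ` B)"
  unfolding J_set_def
proof (intro allI impI)
  fix F :: "(nat \<Rightarrow> 'a diff_group) set"
  assume F: "finite F \<and> F \<noteq> {}"
  have "\<exists>b. \<forall>f\<in>F. diff_embed b + f n \<in> range diff_embed" for n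
    using common_denominator[of "(\<lambda>f. f n) ` F"] F by simp
  \<comment> \<open>The denominator may vary with \<open>n\<close> but not with \<open>f\<close>: it
    will go into coefficients shared by all of \<open>F\<close>.\<close>
  then have "\<exists>b. \<forall>n. \<forall>f\<in>F. diff_embed (b n) + f n \<in> range diff_embed"
    by (intro choice allI)
  then obtain b where b: "\<And>n f. f \<in> F \<Longrightarrow> diff_embed (b n) + f n \<in> range diff_embed"
    by blast
  define g where "g f n = inv diff_embed (diff_embed (b n) + f n)" for f n
  have g: "diff_embed (g f n) = diff_embed (b n) + f n" if "f \<in> F" for f n
    using b[OF that] by (simp add: g_def f_inv_into_f)
  have "finite (g ` F) \<and> g ` F \<noteq> {}" using F by simp
  with assms obtain m a t where m: "1 \<le> m"
    and t: "\<forall>j\<in>{1..m}. 1 \<le> t j" "strict_mono_on {1..m} t"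
    and mem: "\<forall>h\<in>g ` F. semigroup_sum (\<lambda>j. a j + h (t j)) m + a (m + 1) \<in> B"
    unfolding J_set_def by meson
  \<comment> \<open>The coefficient at \<open>m + 1\<close> is paired with no sequence term, so it
    receives no shift.\<close>
  define a' where "a' j = (if j \<le> m then diff_embed (a j + b (t j)) else diff_embed (a j))" for j
  have "semigroup_sum (\<lambda>j. a' j + f (t j)) m + a' (m + 1) \<in> diff_embed ` B" if f: "f \<in> F" for f
  proof -
    have "semigroup_sum (\<lambda>j. a' j + f (t j)) m
        = semigroup_sum (\<lambda>j. diff_embed (a j + g f (t j))) m"
      by (rule semigroup_sum_cong[OF m]) (simp add: a'_def diff_embed_add g[OF f] add.assoc)
    then have "semigroup_sum (\<lambda>j. a' j + f (t j)) m + a' (m + 1)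
        = diff_embed (semigroup_sum (\<lambda>j. a j + g f (t j)) m + a (m + 1))"
      by (simp add: a'_def diff_embed_add diff_embed_semigroup_sum[OF m])
    then show ?thesis using mem f by simp
  qed
  then show "\<exists>m a t. 1 \<le> m \<and> (\<forall>j\<in>{1..m}. 1 \<le> t j) \<and> strict_mono_on {1..m} t \<and>
      (\<forall>f\<in>F. semigroup_sum (\<lambda>j. a j + f (t j)) m + a (m + 1) \<in> diff_embed ` B)"
    using m t by blast
qed

text \<open>The index set and its order stay the same. Only translations by embedded semigroup
  elements occur, so the old \<open>G\<close> still serves in the translation condition.\<close>

lemma C_set_family_diff_embed:
  assumes "C_set_family A I ge C"
  shows "C_set_family (diff_embed ` A) I ge (\<lambda>F. diff_embed ` C F)"
proof -
  have dd: "downward_directed I ge C" and sub: "\<forall>F\<in>I. C F \<subseteq> A"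
    and tr: "\<And>F x. F \<in> I \<Longrightarrow> x \<in> C F \<Longrightarrow> \<exists>G\<in>I. C G \<subseteq> neg_translate x (C F)"
    and J: "\<And>\<F>. finite \<F> \<Longrightarrow> \<F> \<noteq> {} \<Longrightarrow> \<F> \<subseteq> I \<Longrightarrow> J_set (\<Inter>F\<in>\<F>. C F)"
    using assms by (auto simp: C_set_family_def)
  have "downward_directed I ge (\<lambda>F. diff_embed ` C F)"
    using dd unfolding downward_directed_def by (meson image_mono)
  moreover have "\<exists>G\<in>I. diff_embed ` C G \<subseteq> neg_translate x (diff_embed ` C F)"
    if F: "F \<in> I" and x: "x \<in> diff_embed ` C F" for F x
  proof -
    from x obtain y where y: "y \<in> C F" "x = diff_embed y" by blast
    with tr F obtain G where "G \<in> I" "C G \<subseteq> neg_translate y (C F)" by blast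
    then have "diff_embed ` C G \<subseteq> neg_translate x (diff_embed ` C F)"
      by (auto simp: neg_translate_def y(2) simp flip: diff_embed_add)
    with \<open>G \<in> I\<close> show ?thesis by blast
  qed
  moreover have "J_set (\<Inter>F\<in>\<F>. diff_embed ` C F)"
    if \<F>: "finite \<F>" "\<F> \<noteq> {}" "\<F> \<subseteq> I" for \<F>
  proof -
    \<comment> \<open>Images under an injective map commute with nonempty intersections.\<close>
    have "(\<Inter>F\<in>\<F>. diff_embed ` C F) = diff_embed ` (\<Inter>F\<in>\<F>. C F)"
      using \<F>(2) image_INT[OF inj_diff_embed, of \<F> C] by blast
    then show ?thesis using J_set_diff_embed[OF J[OF \<F>]] by simp
  qed
  ultimately show ?thesis
    using sub unfolding C_set_family_def by (simp add: image_mono)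
qed

theorem theorem2p6:
  fixes A :: "'a::{ab_semigroup_add, cancel_semigroup_add} set"
  assumes "C_set A"
  shows "C_set (diff_embed ` A)"
  \<comment> \<open>The indices at hand are subsets of the semigroup, whereas \<open>C_set\<close>
    in the group asks for subsets of the group; \<open>C_setI\<close> re-indexes.\<close>
  using assms C_setI[OF C_set_family_diff_embed] unfolding C_set_def[of A] by blast

end
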